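(* Suppose Assumptions 1 and 2 (listed in the context) hold, and let $\{w^k\}_{k\ge 0}=\{(u^k,v^k,p^k)\}_{k\ge0}$ be a sequence generated by the algorithm NAPP-AL (described in the context) where at every iteration $k$ one sets $$\delta_k := \beta \left(L_G+\|q^k\|L_{\Omega}+\gamma (L^0_{\Theta})^2+\frac{14\gamma\|B\|^2(L^0_{\Theta})^2}{\lambda_{\min}(B^{\top}B)}+\frac{14(L_G+\gamma\|B\| L^0_{\Theta})^2}{\gamma\lambda_{\min}(B^{\top}B)}+1\right)^{-1}.$$ Let $\bar w$ be an accumulation point of $\{w^k\}$. If $\mathcal{L}_{\gamma}$ satisfies the Kurdyka-{\L}ojasiewicz property at $\bar w$ with exponent $\theta=\frac12$ and constants $\eta>0$, $\nu>0$, $\kappa_2>0$, then the value proximity error bound (VP-EB) condition holds at $\bar w$ (both properties are defined in the context).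
   Context: Problem (P): minimize $F(u,v):=G(u,v)+J(u)+H(v)$ subject to $\Theta(u)+Bv=0$, $u\in\mathbf{U}$, $v\in\mathbf{R}^d$, where $\mathbf{U}\subseteq\mathbf{R}^n$ is nonempty, closed and convex, $\Theta=\Omega+\Phi:\mathbf{R}^n\to\mathbf{R}^m$ with $\Omega,\Phi$ differentiable, and $B\in\mathbf{R}^{m\times d}$. $\|\cdot\|$ is the Euclidean norm (spectral norm for matrices), $\lambda_{\min}$ the smallest eigenvalue, and ${\rm dist}(x,\mathbf{C})=\inf\{\|x-z\|:z\in \mathbf{C}\}$ ($+\infty$ if $\mathbf{C}=\emptyset$). Assumption 1. (H1) $G:\mathbf{R}^n\times\mathbf{R}^d\to\mathbf{R}$ is differentiable (possibly nonconvex) with $L_G$-Lipschitz gradient. (H2) $H:\mathbf{R}^d\to\mathbf{R}$ is differentiable (possibly nonconvex) with $L_H$-Lipschitz gradient. (H3) $J:\mathbf{R}^n\to(-\infty,+\infty]$ is proper and lower semicontinuous (possibly nonconvex); if $\mathbf{U}=\mathbf{R}^n$, ${\rm dom}(J)$ is convex; if $\mathbf{U}\neq\mathbf{R}^n$, $J$ is locally Lipschitz continuous around every point of ${\rm dom}(J)\cap\mathbf{U}$. (H4) $\|\Theta(u)-\Theta(u')\|\le L^0_\Theta\|u-u'\|$ for all $u,u'$. (H5) $\Omega=(\Omega_1,\dots,\Omega_m)^\top$ where each $\Omega_j:\mathbf{R}^n\to\mathbf{R}$ has $L_{\Omega_j}$-Lipschitz gradient; $L_\Omega:=\sum_{j=1}^m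 L_{\Omega_j}$. (H6) $B$ is a tall matrix of full column rank and ${\rm Im}(\Theta)\subseteq{\rm Im}(B)$. (H7) $F$ is bounded below and coercive over $\{(u,v)\in\mathbf{R}^n\times\mathbf{R}^d:\Theta(u)+Bv=0\}$ (coercive: $F(u,v)\to+\infty$ as $\|(u,v)\|\to\infty$ within this set). Assumption 2. (i) $K:\mathbf{R}^n\to\mathbf{R}$ is differentiable, $\beta$-strongly convex ($\beta>0$), with $L_K$-Lipschitz gradient. (ii) $\gamma>\frac{\sqrt{57}+1}{2\lambda_{\min}(B^\top B)}(L_G+L_H)$ (and $\gamma>0$). Bregman distance: $D(u,u')=K(u)-K(u')-\langle\nabla K(u'),u-u'\rangle$. Algorithm NAPP-AL. Fix $\sigma\in(0,1)$ and start from $u^0\in\mathbf{R}^n,v^0\in\mathbf{R}^d,p^0\in\mathbf{R}^m$. For $k=0,1,2,\dots$: set $q^k=p^k+\gamma(\Theta(u^k)+Bv^k)$, take $\delta_k>0$ and $\epsilon^k$ with $\sigma\delta_k\le\epsilon^k\le\delta_k$, and let $$u^{k+1}\in\arg\min_{u\in\mathbf{U}}\ \langle\nabla_uG(u^k,v^k),u\rangle+J(u)+\langle q^k,\nabla\Omega(u^k)u+\Phi(u)\rangle+\tfrac1{\epsilon^k}D(u,u^k),$$ $$v^{k+1}=\arg\min_{v\in\mathbf{R}^d}\ \langle\nabla_vG(u^k,v^k)+\nabla H(v^k),v\rangle+\langle q^k,Bv\rangle+\tfrac\gamma2\|B(v-v^k)\|^2,$$ $$p^{k+1}=p^k+\gamma(\Theta(u^{k+1})+Bv^{k+1}).$$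 The $u$-subproblem is assumed to be solved to global optimality (a global minimizer is assumed to exist). Write $w^k=(u^k,v^k,p^k)$. Augmented Lagrangian: for $w=(u,v,p)$, $\mathcal{L}_\gamma(w)=F(u,v)+\langle p,\Theta(u)+Bv\rangle+\frac\gamma2\|\Theta(u)+Bv\|^2$. For $w\in\mathbf{U}\times\mathbf{R}^d\times\mathbf{R}^m$, $\partial\mathcal{L}_\gamma(w)$ denotes the product of the three sets $\nabla_uG(u,v)+\partial J(u)+\mathcal{N}_{\mathbf{U}}(u)+(\nabla\Theta(u))^\top[p+\gamma(\Theta(u)+Bv)]$, $\{\nabla_vG(u,v)+\nabla H(v)+B^\top[p+\gamma(\Theta(u)+Bv)]\}$, $\{\Theta(u)+Bv\}$, where $\partial J$ is the limiting (Mordukhovich) subdifferential and $\mathcal{N}_{\mathbf{U}}(u)=\{\xi:\langle\xi,\zeta-u\rangle\le0\ \forall\zeta\in\mathbf{U}\}$; for $u\notin\mathbf{U}$ it is empty. $\Lambda^*:=\mathcal{L}_\gamma(\bar w)$, which under these assumptions is the common value of $\mathcal{L}_\gamma$ at all cluster points of $\{w^k\}$ and equals $\lim_k\mathcal{L}_\gamma(w^k)$; all cluster points are stationary points of (P), i.e. satisfy $0\in\partial\mathcal{L}_\gamma(\bar w)$. $\mathbb{B}(\bar w;\eta)$ is the open ball of radius $\eta$ centered at $\bar w$. Kurdyka-{\L}ojasiewicz property of $\mathcal{L}_\gamma$ at $\bar w$ with exponent $\theta\in(0,1)$ and constants $\eta,\nu,\kappa_2>0$: $[\mathcal{L}_\gamma(w)-\mathcal{L}_\gamma(\bar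 w)]^\theta\le\kappa_2\,{\rm dist}(0,\partial\mathcal{L}_\gamma(w))$ for all $w\in\mathbb{B}(\bar w;\eta)$ with $\Lambda^*<\mathcal{L}_\gamma(w)<\Lambda^*+\nu$. VP-EB condition at $\bar w$ for the sequence $\{w^k\}$: there exist $\kappa_1>0,\eta>0,\nu>0$ such that $\mathcal{L}_\gamma(w^{k+1})-\Lambda^*\le\kappa_1\|w^k-w^{k+1}\|^2$ for every $k$ with $w^{k+1}\in\mathbb{B}(\bar w;\eta)$ and $\mathcal{L}_\gamma(w^{k+1})<\Lambda^*+\nu$. *)

theory Defs
  imports "HOL-Analysis.Analysis"
begin

definition gradient :: "('a::real_inner \<Rightarrow> real) \<Rightarrow> 'a \<Rightarrow> 'a" where
  "gradient f x = (THE D. GDERIV f x :> D)"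

definition strongly_convex :: "real \<Rightarrow> ('a::real_inner \<Rightarrow> real) \<Rightarrow> bool" where
  "strongly_convex \<beta> f \<longleftrightarrow>
     (\<forall>x y. \<forall>t\<in>{0..1}. f (t *\<^sub>R x + (1 - t) *\<^sub>R y)
        \<le> t * f x + (1 - t) * f y - \<beta> / 2 * t * (1 - t) * (norm (x - y))\<^sup>2)"

definition bregman :: "('a::real_inner \<Rightarrow> real) \<Rightarrow> 'a \<Rightarrow> 'a \<Rightarrow> real" where
  "bregman K u u' = K u - K u' - gradient K u' \<bullet> (u - u')"

(* Only used for the symmetric matrix B^T B, which has a smallest eigenvalue. *)
definition lambda_min :: "(real^'n^'n) \<Rightarrow> real" where
  "lambda_min A = (LEAST \<mu>. \<exists>x. x \<noteq> 0 \<and> A *v x = \<mu> *\<^sub>R x)"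

definition spectral_norm :: "(real^'n^'m) \<Rightarrow> real" where
  "spectral_norm A = onorm ((*v) A)"

(* In the type ereal the infimum over the empty set is infinity. *)
definition edist :: "'a::real_normed_vector \<Rightarrow> 'a set \<Rightarrow> ereal" where
  "edist x C = (INF z\<in>C. ereal (norm (x - z)))"

definition edom :: "('a \<Rightarrow> ereal) \<Rightarrow> 'a set" where
  "edom f = {x. f x < \<infinity>}"

definition proper :: "('a \<Rightarrow> ereal) \<Rightarrow> bool" where
  "proper f \<longleftrightarrow> (\<forall>x. f x \<noteq> -\<infinity>) \<and> edom f \<noteq> {}"

definition lower_semicontinuous :: "('a::topological_space \<Rightarrow> ereal) \<Rightarrow> bool" where
  "lower_semicontinuous f \<longleftrightarrow> (\<forall>x. f x \<le> Liminf (at x) f)"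

(* In particular, f is finite on a neighbourhood of x. *)
definition lipschitz_around :: "('a::metric_space \<Rightarrow> ereal) \<Rightarrow> 'a \<Rightarrow> bool" where
  "lipschitz_around f x \<longleftrightarrow>
     (\<exists>r>0. \<exists>L. (\<forall>y\<in>ball x r. \<bar>f y\<bar> \<noteq> \<infinity>) \<and>
        L-lipschitz_on (ball x r) (\<lambda>y. real_of_ereal (f y)))"

definition frechet_subdifferential :: "('a::real_inner \<Rightarrow> ereal) \<Rightarrow> 'a \<Rightarrow> 'a set" where
  "frechet_subdifferential f x =
     {\<xi>. \<bar>f x\<bar> \<noteq> \<infinity> \<and>
        0 \<le> Liminf (at x) (\<lambda>y. (f y - f x - ereal (\<xi> \<bullet> (y - x))) / ereal (norm (y - x)))}"

(* The Mordukhovich subdifferential; empty where f is not finite. *)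
definition limiting_subdifferential :: "('a::real_inner \<Rightarrow> ereal) \<Rightarrow> 'a \<Rightarrow> 'a set" where
  "limiting_subdifferential f x =
     {\<xi>. \<bar>f x\<bar> \<noteq> \<infinity> \<and>
        (\<exists>X \<Xi>. X \<longlonglongrightarrow> x \<and> (\<lambda>k. f (X k)) \<longlonglongrightarrow> f x \<and>
           (\<forall>k. \<Xi> k \<in> frechet_subdifferential f (X k)) \<and> \<Xi> \<longlonglongrightarrow> \<xi>)}"

definition normal_cone :: "'a::real_inner set \<Rightarrow> 'a \<Rightarrow> 'a set" where
  "normal_cone U u = {\<xi>. \<forall>\<zeta>\<in>U. \<xi> \<bullet> (\<zeta> - u) \<le> 0}"

definition accumulation_point :: "(nat \<Rightarrow> 'a::topological_space) \<Rightarrow> 'a \<Rightarrow> bool" where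
  "accumulation_point w a \<longleftrightarrow> (\<exists>r. strict_mono r \<and> (w \<circ> r) \<longlonglongrightarrow> a)"

definition objective ::
  "((real^'n) \<times> (real^'d) \<Rightarrow> real) \<Rightarrow> ((real^'n) \<Rightarrow> ereal) \<Rightarrow> ((real^'d) \<Rightarrow> real)
     \<Rightarrow> (real^'n) \<times> (real^'d) \<Rightarrow> ereal" where
  "objective G J H = (\<lambda>(u, v). ereal (G (u, v)) + J u + ereal (H v))"

definition augmented_lagrangian ::
  "((real^'n) \<times> (real^'d) \<Rightarrow> real) \<Rightarrow> ((real^'n) \<Rightarrow> ereal) \<Rightarrow> ((real^'d) \<Rightarrow> real)
     \<Rightarrow> ((real^'n) \<Rightarrow> (real^'m)) \<Rightarrow> (real^'d^'m) \<Rightarrow> real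
     \<Rightarrow> (real^'n) \<times> (real^'d) \<times> (real^'m) \<Rightarrow> ereal" where
  "augmented_lagrangian G J H \<Theta> B \<gamma> = (\<lambda>(u, v, p).
     objective G J H (u, v) + ereal (p \<bullet> (\<Theta> u + B *v v))
       + ereal (\<gamma> / 2 * (norm (\<Theta> u + B *v v))\<^sup>2))"

definition augmented_lagrangian_subdifferential ::
  "(real^'n) set \<Rightarrow> ((real^'n) \<times> (real^'d) \<Rightarrow> real) \<Rightarrow> ((real^'n) \<Rightarrow> ereal) \<Rightarrow> ((real^'d) \<Rightarrow> real)
     \<Rightarrow> ((real^'n) \<Rightarrow> (real^'m)) \<Rightarrow> (real^'d^'m) \<Rightarrow> real
     \<Rightarrow> (real^'n) \<times> (real^'d) \<times> (real^'m) \<Rightarrow> ((real^'n) \<times> (real^'d) \<times> (real^'m)) set" where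
  "augmented_lagrangian_subdifferential U G J H \<Theta> B \<gamma> = (\<lambda>(u, v, p).
     if u \<in> U then
       {gradient (\<lambda>u'. G (u', v)) u + \<xi> + \<zeta>
          + transpose (jacobian \<Theta> (at u)) *v (p + \<gamma> *\<^sub>R (\<Theta> u + B *v v)) | \<xi> \<zeta>.
          \<xi> \<in> limiting_subdifferential J u \<and> \<zeta> \<in> normal_cone U u}
       \<times> {gradient (\<lambda>v'. G (u, v')) v + gradient H v
            + transpose B *v (p + \<gamma> *\<^sub>R (\<Theta> u + B *v v))}
       \<times> {\<Theta> u + B *v v}
     else {})"

(* The Kurdyka-Lojasiewicz property of f at a with exponent \<theta>, with S playing the role of the
   subdifferential.  If f has no value -\<infinity>, then f a and f w are both finite wherever the
   inequality is required, so real_of_ereal is harmless. *)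
definition KL_property ::
  "('a::real_normed_vector \<Rightarrow> ereal) \<Rightarrow> ('a \<Rightarrow> 'a set) \<Rightarrow> 'a
     \<Rightarrow> real \<Rightarrow> real \<Rightarrow> real \<Rightarrow> real \<Rightarrow> bool" where
  "KL_property f S a \<theta> \<eta> \<nu> \<kappa> \<longleftrightarrow>
     0 < \<theta> \<and> \<theta> < 1 \<and> 0 < \<eta> \<and> 0 < \<nu> \<and> 0 < \<kappa> \<and>
     (\<forall>w\<in>ball a \<eta>. f a < f w \<and> f w < f a + ereal \<nu> \<longrightarrow>
        ereal (real_of_ereal (f w - f a) powr \<theta>) \<le> ereal \<kappa> * edist 0 (S w))"

definition VP_EB ::
  "('a::real_normed_vector \<Rightarrow> ereal) \<Rightarrow> (nat \<Rightarrow> 'a) \<Rightarrow> 'a \<Rightarrow> bool" where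
  "VP_EB f w a \<longleftrightarrow>
     (\<exists>\<kappa>>0. \<exists>\<eta>>0. \<exists>\<nu>>0. \<forall>k. w (Suc k) \<in> ball a \<eta> \<and> f (w (Suc k)) < f a + ereal \<nu> \<longrightarrow>
        f (w (Suc k)) - f a \<le> ereal (\<kappa> * (norm (w k - w (Suc k)))\<^sup>2))"

end

theory Submission
  imports Defs
begin

text \<open>
  By the Kurdyka-Lojasiewicz inequality with exponent 1/2 it suffices to find in the subdifferential
  at \<open>w (Suc k)\<close> an element of norm at most \<open>C * norm (w k - w (Suc k))\<close>. Such an element comes from
  the optimality conditions of the two subproblems, by subtracting them from the subdifferential at
  the new point: all remaining terms are differences of Lipschitz maps. The constant \<open>C\<close> depends on
  a bound for \<open>q k\<close>, which is available as soon as \<open>w k\<close> is bounded. Only \<open>w (Suc k)\<close> is known to be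
  near the accumulation point, but for steps longer than 1 the value gap is below
  \<open>\<nu> \<le> \<nu> * (norm (w k - w (Suc k)))\<^sup>2\<close> anyway.

  The optimality condition of the nonsmooth subproblem over \<open>U\<close> requires the sum rule for a locally
  Lipschitz function and the indicator of a closed convex set, obtained by quadratic penalisation.
\<close>

section \<open>Gradients and partial gradients\<close>

lemma gradient_eqI:
  fixes f :: "'a::real_inner \<Rightarrow> real"
  assumes D: "(f has_derivative (\<lambda>h. D \<bullet> h)) (at x)"
  shows "gradient f x = D"
  unfolding gradient_def
proof (rule the_equality)
  show "GDERIV f x :> D" using D by (simp add: gderiv_def inner_commute)
  show "E = D" if "GDERIV f x :> E" for E
  proof -
    have "(\<lambda>h. D \<bullet> h) = (\<lambda>h. h \<bullet> E)"
      using has_derivative_unique[OF D] that by (simp add: gderiv_def)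
    then show ?thesis by (metis inner_commute vector_eq_rdot)
  qed
qed

text \<open>The derivative is a linear functional, hence the inner product with its Riesz
  representative, whose coordinates are its values on the basis. Uniqueness identifies this vector
  with \<open>gradient f x\<close>.\<close>

lemma has_derivative_gradient:
  fixes f :: "'a::euclidean_space \<Rightarrow> real"
  assumes "f differentiable (at x)"
  shows "(f has_derivative (\<lambda>h. gradient f x \<bullet> h)) (at x)"
proof -
  obtain f' where f': "(f has_derivative f') (at x)"
    using assms by (auto simp: differentiable_def)
  interpret bounded_linear f' using f' by (rule has_derivative_bounded_linear)
  define D where "D = (\<Sum>b\<in>Basis. f' b *\<^sub>R b)"
  have "f' h = h \<bullet> D" for h
  proof -
    have "f' h = f' (\<Sum>b\<in>Basis. (h \<bullet> b) *\<^sub>R b)" by (simp add: euclidean_representation)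
    also have "\<dots> = (\<Sum>b\<in>Basis. (h \<bullet> b) * f' b)" by (simp add: sum scaleR)
    finally show ?thesis by (simp add: D_def inner_sum_right mult.commute)
  qed
  then have D: "f' = (\<lambda>h. D \<bullet> h)" by (auto simp: inner_commute)
  with f' have "gradient f x = D" by (intro gradient_eqI) simp
  with f' D show ?thesis by simp
qed

text \<open>The algorithm uses partial gradients, whereas the Lipschitz hypothesis concerns the full
  gradient; the chain rule along \<open>x' \<mapsto> (x', y)\<close> links them.\<close>

lemma gradient_Pair_fst:
  fixes G :: "'a::euclidean_space \<times> 'b::euclidean_space \<Rightarrow> real"
  assumes "G differentiable (at (x, y))"
  shows "gradient (\<lambda>x'. G (x', y)) x = fst (gradient G (x, y))"
proof (rule gradient_eqI)
  have "((\<lambda>x'. (x', y)) has_derivative (\<lambda>h. (h, 0))) (at x)"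
    by (auto intro!: derivative_eq_intros)
  from has_derivative_compose[OF this has_derivative_gradient[OF assms]]
  show "((\<lambda>x'. G (x', y)) has_derivative (\<lambda>h. fst (gradient G (x, y)) \<bullet> h)) (at x)"
    by (simp add: inner_prod_def)
qed

lemma gradient_Pair_snd:
  fixes G :: "'a::euclidean_space \<times> 'b::euclidean_space \<Rightarrow> real"
  assumes "G differentiable (at (x, y))"
  shows "gradient (\<lambda>y'. G (x, y')) y = snd (gradient G (x, y))"
proof (rule gradient_eqI)
  have "((\<lambda>y'. (x, y')) has_derivative (\<lambda>h. (0, h))) (at y)"
    by (auto intro!: derivative_eq_intros)
  from has_derivative_compose[OF this has_derivative_gradient[OF assms]]
  show "((\<lambda>y'. G (x, y')) has_derivative (\<lambda>h. snd (gradient G (x, y)) \<bullet> h)) (at y)"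
    by (simp add: inner_prod_def)
qed

section \<open>Jacobians of Lipschitz maps and of maps with Lipschitz component gradients\<close>

lemma inner_transpose_matrix_vector:
  fixes A :: "real^'n^'m"
  shows "(transpose A *v y) \<bullet> x = y \<bullet> (A *v x)"
  by (simp add: dot_lmul_matrix)

lemma jacobian_unique:
  fixes f :: "real^'n \<Rightarrow> real^'m"
  assumes "(f has_derivative (\<lambda>h. A *v h)) (at x)"
  shows "jacobian f (at x) = A"
  by (metis assms frechet_derivative_at jacobian_def matrix_of_matrix_vector_mul)

text \<open>Increments along the ray through \<open>h\<close> are at most \<open>L\<close> times its
  length, and the derivative approximates them up to an arbitrarily small relative error.\<close>

lemma lipschitz_has_derivative_bound:
  fixes f :: "'a::real_normed_vector \<Rightarrow> 'b::real_normed_vector"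
  assumes f: "(f has_derivative f') (at x)" and L: "L-lipschitz_on UNIV f"
  shows "norm (f' h) \<le> L * norm h"
proof (cases "h = 0")
  case True
  interpret bounded_linear f' using f by (rule has_derivative_bounded_linear)
  show ?thesis using True by (simp add: zero)
next
  case False
  interpret bounded_linear f' using f by (rule has_derivative_bounded_linear)
  show ?thesis
  proof (rule field_le_epsilon)
    fix e :: real assume "e > 0"
    then have "e / norm h > 0" using False by simp
    with f obtain d where d: "d > 0"
      "\<And>y. norm (y - x) < d \<Longrightarrow> norm (f y - f x - f' (y - x)) \<le> e / norm h * norm (y - x)"
      unfolding has_derivative_at_alt by blast
    \<comment> \<open>Half the admissible radius: the linearisation error is then at most
      \<open>t * e\<close>, and division by \<open>t\<close> leaves the slack
      \<open>e\<close>.\<close>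
    define t where "t = d / (2 * norm h)"
    have t: "t > 0" "t * norm h < d" using d(1) False by (simp_all add: t_def field_simps)
    have "norm (f (x + t *\<^sub>R h) - f x - t *\<^sub>R f' h) \<le> t * e"
      using d(2)[of "x + t *\<^sub>R h"] t False by (simp add: scaleR mult.commute)
    moreover have "norm (f (x + t *\<^sub>R h) - f x) \<le> L * (t * norm h)"
      using lipschitz_onD[OF L, of "x + t *\<^sub>R h" x] t by (simp add: dist_norm)
    moreover have "norm (t *\<^sub>R f' h) \<le> norm (f (x + t *\<^sub>R h) - f x)
        + norm (f (x + t *\<^sub>R h) - f x - t *\<^sub>R f' h)"
      by (metis norm_triangle_sub norm_minus_commute)
    ultimately have "t * norm (f' h) \<le> t * (L * norm h + e)"
      using t by (simp add: algebra_simps)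
    then show "norm (f' h) \<le> L * norm h + e" using t by simp
  qed
qed

text \<open>A matrix and its transpose have the same operator norm: pair the image vector
  \<open>?z\<close> with itself, move the transpose across and cancel one factor
  \<open>norm ?z\<close>.\<close>

lemma norm_transpose_jacobian_le:
  fixes f :: "real^'n \<Rightarrow> real^'m"
  assumes "f differentiable (at x)" and L: "L-lipschitz_on UNIV f"
  shows "norm (transpose (jacobian f (at x)) *v y) \<le> L * norm y"
proof -
  let ?z = "transpose (jacobian f (at x)) *v y"
  have "norm ?z * norm ?z = y \<bullet> (jacobian f (at x) *v ?z)"
    by (metis inner_transpose_matrix_vector power2_eq_square power2_norm_eq_inner)
  also have "\<dots> \<le> norm y * norm (jacobian f (at x) *v ?z)" by (rule norm_cauchy_schwarz)
  also have "\<dots> \<le> norm y * (L * norm ?z)"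
    by (intro mult_left_mono lipschitz_has_derivative_bound[OF jacobian_works[THEN iffD1, OF assms(1)] L]) simp
  finally have "norm ?z * norm ?z \<le> (L * norm y) * norm ?z" by (simp add: mult_ac)
  then show ?thesis
    using lipschitz_on_nonneg[OF L] by (cases "?z = 0") simp_all
qed

text \<open>The rows of the Jacobian are the gradients of the components, so componentwise Lipschitz
  hypotheses become usable for the transposed Jacobian.\<close>

lemma transpose_jacobian_vector:
  fixes f :: "real^'n \<Rightarrow> real^'m"
  assumes "f differentiable (at x)"
  shows "transpose (jacobian f (at x)) *v y = (\<Sum>j\<in>UNIV. y $ j *\<^sub>R gradient (\<lambda>x. f x $ j) x)"
proof -
  have "gradient (\<lambda>x. f x $ j) x = row j (jacobian f (at x))" for j
  proof (rule gradient_eqI)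
    have "((\<lambda>x. f x $ j) has_derivative (\<lambda>h. (jacobian f (at x) *v h) $ j)) (at x)"
      by (rule bounded_linear.has_derivative[OF bounded_linear_vec_nth jacobian_works[THEN iffD1, OF assms]])
    then show "((\<lambda>x. f x $ j) has_derivative (\<lambda>h. row j (jacobian f (at x)) \<bullet> h)) (at x)"
      by (simp add: matrix_vector_mul_component row_def)
  qed
  then show ?thesis
    by (simp add: matrix_mult_sum scalar_mult_eq_scaleR del: transpose_matrix_vector)
qed

lemma norm_transpose_jacobian_diff_le:
  fixes f :: "real^'n \<Rightarrow> real^'m"
  assumes diff: "\<And>x. f differentiable (at x)"
    and lip: "\<And>j. (l j)-lipschitz_on UNIV (gradient (\<lambda>x. f x $ j))"
  shows "norm (transpose (jacobian f (at x)) *v y - transpose (jacobian f (at x')) *v y)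
      \<le> norm y * (\<Sum>j\<in>UNIV. l j) * norm (x - x')"
proof -
  let ?g = "\<lambda>j. gradient (\<lambda>x. f x $ j)"
  have "transpose (jacobian f (at x)) *v y - transpose (jacobian f (at x')) *v y
      = (\<Sum>j\<in>UNIV. y $ j *\<^sub>R (?g j x - ?g j x'))"
    by (simp add: transpose_jacobian_vector[OF diff] sum_subtractf scaleR_diff_right
        del: transpose_matrix_vector)
  also have "norm \<dots> \<le> (\<Sum>j\<in>UNIV. norm y * (l j * norm (x - x')))"
  proof (rule sum_norm_le)
    fix j
    have "norm (?g j x - ?g j x') \<le> l j * norm (x - x')"
      using lipschitz_onD[OF lip, of x x' j] by (simp add: dist_norm)
    then show "norm (y $ j *\<^sub>R (?g j x - ?g j x')) \<le> norm y * (l j * norm (x - x'))"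
      by (auto intro!: mult_mono component_le_norm_cart)
  qed
  finally show ?thesis by (simp add: sum_distrib_left sum_distrib_right mult.assoc)
qed

section \<open>Frechet and limiting subgradients\<close>

text \<open>A form of the lower limit condition free of quotients of extended reals. For a negative
  level \<open>c\<close>, a real \<open>d\<close> strictly between \<open>c\<close> and 0 supplies
  the slack \<open>e = - d\<close>.\<close>

lemma frechet_subdifferentialI:
  assumes fin: "\<bar>f x\<bar> \<noteq> \<infinity>"
    and ev: "\<And>e. e > 0 \<Longrightarrow> \<forall>\<^sub>F y in at x. f x + ereal (\<xi> \<bullet> (y - x) - e * norm (y - x)) \<le> f y"
  shows "\<xi> \<in> frechet_subdifferential f x"
proof -
  obtain a where a: "f x = ereal a" using fin by (cases "f x") auto
  have "\<forall>\<^sub>F y in at x. c < (f y - f x - ereal (\<xi> \<bullet> (y - x))) / ereal (norm (y - x))"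
    if c: "c < 0" for c
  proof -
    obtain d where d: "c < ereal d" "ereal d < 0" using ereal_dense2[OF c] by blast
    have "\<forall>\<^sub>F y in at x. f x + ereal (\<xi> \<bullet> (y - x) - (- d) * norm (y - x)) \<le> f y"
      by (rule ev) (use d in simp)
    moreover have "\<forall>\<^sub>F y in at x. y \<noteq> x" by (auto simp: eventually_at_filter)
    ultimately show ?thesis
    proof eventually_elim
      case (elim y)
      then have n: "norm (y - x) > 0" by simp
      show ?case
      proof (cases "f y")
        case (real b)
        have "d \<le> (b - a - \<xi> \<bullet> (y - x)) / norm (y - x)"
          using elim n by (simp add: a real field_simps)
        with d show ?thesis using n by (simp add: a real less_le_trans)
      next
        case PInf
        then show ?thesis using n d by (simp add: a) (metis less_ereal.simps(2) order.strict_trans)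
      next
        case MInf
        then show ?thesis using elim by (simp add: a)
      qed
    qed
  qed
  then show ?thesis using fin by (simp add: frechet_subdifferential_def le_Liminf_iff)
qed

lemma frechet_subdifferential_subset_limiting:
  "frechet_subdifferential f x \<subseteq> limiting_subdifferential f x"
proof
  fix \<xi> assume \<xi>: "\<xi> \<in> frechet_subdifferential f x"
  then show "\<xi> \<in> limiting_subdifferential f x"
    unfolding limiting_subdifferential_def mem_Collect_eq
    by (intro conjI exI[of _ "\<lambda>_. x"] exI[of _ "\<lambda>_. \<xi>"])
      (auto simp: frechet_subdifferential_def)
qed

text \<open>Local minimality bounds the decrease of \<open>J\<close> by the increase of
  \<open>g\<close>, and \<open>g\<close> is linear up to a small multiple of the distance.\<close>

lemma frechet_subdifferential_fermat:
  fixes J :: "'a::real_inner \<Rightarrow> ereal"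
  assumes fin: "\<bar>J x\<bar> \<noteq> \<infinity>"
    and g: "(g has_derivative (\<lambda>h. a \<bullet> h)) (at x)"
    and min: "\<forall>\<^sub>F y in at x. J x + ereal (g x) \<le> J y + ereal (g y)"
  shows "- a \<in> frechet_subdifferential J x"
proof (rule frechet_subdifferentialI)
  show "\<bar>J x\<bar> \<noteq> \<infinity>" by (rule fin)
next
  fix e :: real assume "e > 0"
  with g obtain d where d: "d > 0"
    "\<And>y. norm (y - x) < d \<Longrightarrow> norm (g y - g x - a \<bullet> (y - x)) \<le> e * norm (y - x)"
    unfolding has_derivative_at_alt by blast
  have "\<forall>\<^sub>F y in at x. dist y x < d" using d(1) by (auto simp: eventually_at)
  with min show "\<forall>\<^sub>F y in at x. J x + ereal (- a \<bullet> (y - x) - e * norm (y - x)) \<le> J y"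
  proof eventually_elim
    case (elim y)
    then have "norm (g y - g x - a \<bullet> (y - x)) \<le> e * norm (y - x)"
      by (intro d(2)) (simp add: dist_norm)
    then show ?case using elim(1) fin by (cases "J x"; cases "J y") auto
  qed
qed

section \<open>First-order optimality over a closed convex set\<close>

text \<open>
  The constraint \<open>y \<in> U\<close> is decoupled from \<open>J\<close> by minimising
  \<open>J s + a \<bullet> (s - x) + e * norm (t - x) + n * (norm (s - t))\<^sup>2\<close> over \<open>s\<close> near \<open>x\<close> and \<open>t \<in> U\<close> near \<open>x\<close>.
  The term \<open>e * norm (t - x)\<close>, which absorbs the error of linearising \<open>g\<close>, is attached to \<open>t\<close> because
  approximate normals to a convex set, unlike approximate subgradients of \<open>J\<close>, pass to the limit directly.
\<close>

lemma penalised_fermat: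
  fixes J :: "'a::euclidean_space \<Rightarrow> ereal"
  assumes U: "closed U" "convex U" "x \<in> U"
    and J: "0 < r0" "\<And>y. y \<in> ball x r0 \<Longrightarrow> \<bar>J y\<bar> \<noteq> \<infinity>"
      "L-lipschitz_on (ball x r0) (\<lambda>y. real_of_ereal (J y))"
    and g: "(g has_derivative (\<lambda>h. a \<bullet> h)) (at x)"
    and min: "\<And>y. y \<in> U \<Longrightarrow> J x + ereal (g x) \<le> J y + ereal (g y)"
    and e: "0 < e"
  shows "\<exists>x' y z. norm (x' - x) < e \<and> x' \<in> ball x r0 \<and> y \<in> U \<and> norm (y - x) < e
      \<and> norm z \<le> 2 * (L + norm a) \<and> - a - z \<in> frechet_subdifferential J x'
      \<and> (\<forall>\<zeta>\<in>U. z \<bullet> (\<zeta> - y) \<le> e * norm (\<zeta> - y))"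
proof -
  define j where "j y = real_of_ereal (J y)" for y
  have Jj: "J y = ereal (j y)" if "y \<in> ball x r0" for y
    using J(2)[OF that] by (simp add: j_def ereal_real)
  have L: "L \<ge> 0" using J(3) by (rule lipschitz_on_nonneg)
  define M where "M = L + norm a"
  have M: "M \<ge> 0" using L by (simp add: M_def)
  \<comment> \<open>The penalty on \<open>norm (t - x)\<close> has weight
    \<open>2 * \<epsilon> = e\<close>: one half absorbs the linearisation error of \<open>g\<close>,
    the other half forces \<open>t\<close> towards \<open>x\<close>.\<close>
  define \<epsilon> where "\<epsilon> = e / 2"
  have \<epsilon>: "\<epsilon> > 0" using e by (simp add: \<epsilon>_def)
  obtain d where d: "d > 0"
    "\<And>y. norm (y - x) < d \<Longrightarrow> norm (g y - g x - a \<bullet> (y - x)) \<le> \<epsilon> * norm (y - x)"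
    using g \<epsilon> unfolding has_derivative_at_alt by blast
  define r where "r = min r0 (min d e) / 2"
  have r: "r > 0" "r < r0" "r < d" "r < e" using J(1) d(1) e by (auto simp: r_def)
  \<comment> \<open>Large enough that \<open>M / n\<close> and
    \<open>M\<^sup>2 / (n * \<epsilon>)\<close>, which will bound \<open>norm (s - t)\<close> and
    \<open>norm (t - x)\<close>, are both below \<open>r / 2\<close>.\<close>
  define n where "n = 1 + 2 * M / r + 2 * M\<^sup>2 / (\<epsilon> * r)"
  have h: "0 \<le> 2 * M / r" "0 \<le> 2 * M\<^sup>2 / (\<epsilon> * r)" using M r \<epsilon> by simp_all
  then have n: "n > 0" unfolding n_def by linarith
  have "2 * M / r < n" "2 * M\<^sup>2 / (\<epsilon> * r) < n"
    using h unfolding n_def by linarith+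
  then have nM: "M / n < r / 2" "M\<^sup>2 / (n * \<epsilon>) < r / 2"
    using n r \<epsilon> by (auto simp: field_simps)
  have sub: "cball x r \<subseteq> ball x r0" using r by auto
  \<comment> \<open>Only \<open>t\<close> is confined to \<open>U\<close>; \<open>s\<close> moves
    freely in a ball on which \<open>J\<close> is finite and Lipschitz. Compactness yields a
    minimiser.\<close>
  define S where "S = cball x r \<times> (U \<inter> cball x r)"
  define \<psi> where "\<psi> = (\<lambda>(s, t). j s + a \<bullet> (s - x) + 2 * \<epsilon> * norm (t - x) + n * (norm (s - t))\<^sup>2)"
  have "compact S" using U unfolding S_def by (intro compact_Times closed_Int_compact) auto
  moreover have "(x, x) \<in> S" using U r by (auto simp: S_def)
  moreover have "continuous_on S \<psi>"
  proof -
    have "continuous_on (cball x r) j"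
      using lipschitz_on_continuous_on[OF lipschitz_on_subset[OF J(3) sub]] by (simp add: j_def)
    then have "continuous_on S (\<lambda>z. j (fst z))"
      by (rule continuous_on_compose2) (auto simp: S_def intro!: continuous_intros)
    then show ?thesis
      unfolding \<psi>_def case_prod_beta by (intro continuous_intros)
  qed
  ultimately obtain s t where st: "(s, t) \<in> S" "\<And>s' t'. (s', t') \<in> S \<Longrightarrow> \<psi> (s, t) \<le> \<psi> (s', t')"
    using continuous_attains_inf[of S \<psi>] by fast
  have s: "s \<in> cball x r" and t: "t \<in> U" "t \<in> cball x r" using st(1) by (auto simp: S_def)
  have lip: "\<bar>j s - j t\<bar> \<le> L * norm (s - t)"
    using lipschitz_onD[OF J(3) subsetD[OF sub s] subsetD[OF sub t(2)]] by (simp add: j_def dist_norm)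
  have "norm (g t - g x - a \<bullet> (t - x)) \<le> \<epsilon> * norm (t - x)"
    by (rule d(2)) (use t r in \<open>auto simp: dist_norm norm_minus_commute\<close>)
  \<comment> \<open>The minimality of \<open>x\<close> holds only over \<open>U\<close>, so it is
    applied at \<open>t\<close>, not at \<open>s\<close>.\<close>
  moreover have "j x + g x \<le> j t + g t"
    using min[OF t(1)] Jj[of x] Jj[of t] sub t J(1) by auto
  ultimately have jx: "j x \<le> j t + a \<bullet> (t - x) + \<epsilon> * norm (t - x)" by (auto simp: abs_if split: if_splits)
  have "\<psi> (s, t) \<le> j x" using st(2)[of x x] \<open>(x, x) \<in> S\<close> by (simp add: \<psi>_def)
  moreover have "a \<bullet> (t - s) \<le> norm a * norm (s - t)"
    using norm_cauchy_schwarz[of a "t - s"] by (simp add: norm_minus_commute)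
  moreover have "a \<bullet> (t - x) - a \<bullet> (s - x) = a \<bullet> (t - s)" by (simp add: inner_diff_right)
  \<comment> \<open>The minimiser is compared with \<open>(x, x)\<close>. Passing from
    \<open>s\<close> to \<open>t\<close> in \<open>j\<close> and in the linear term costs at most
    \<open>M * norm (s - t)\<close>.\<close>
  ultimately have main: "n * (norm (s - t))\<^sup>2 + \<epsilon> * norm (t - x) \<le> M * norm (s - t)"
    using jx lip by (simp add: \<psi>_def M_def algebra_simps)
  have "n * norm (s - t) * norm (s - t) \<le> M * norm (s - t)"
    using main \<epsilon> by (simp add: power2_eq_square mult.assoc) (smt (verit) mult_nonneg_nonneg norm_ge_zero)
  then have nst: "n * norm (s - t) \<le> M" using M by (cases "s = t") auto
  then have nst': "norm (s - t) \<le> M / n" using n by (simp add: field_simps)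
  have "\<epsilon> * norm (t - x) \<le> M * norm (s - t)" using main n by (smt (verit) mult_nonneg_nonneg zero_le_power2)
  also have "\<dots> \<le> M * (M / n)" using nst' M by (rule mult_left_mono)
  finally have "norm (t - x) \<le> M\<^sup>2 / (n * \<epsilon>)"
    using n \<epsilon> by (simp add: field_simps power2_eq_square)
  then have tx: "norm (t - x) < r / 2" using nM(2) by (rule le_less_trans)
  have "norm (s - x) \<le> norm (s - t) + norm (t - x)" using norm_triangle_ineq[of "s - t" "t - x"] by simp
  \<comment> \<open>Strictness puts \<open>s\<close> in the interior of the ball, so minimality in
    \<open>s\<close> is an unconstrained local one.\<close>
  then have sx: "norm (s - x) < r" using tx nst' nM(1) by linarith
  \<comment> \<open>The gradient in \<open>s\<close> of the quadratic penalty, and minus its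
    gradient in \<open>t\<close>: the subgradient condition and the normal condition share this
    vector.\<close>
  define z where "z = (2 * n) *\<^sub>R (s - t)"
  have "norm z \<le> 2 * (L + norm a)" using nst n by (simp add: z_def M_def)
  moreover have "- a - z \<in> frechet_subdifferential J s"
  proof -
    have "- (a + z) \<in> frechet_subdifferential J s"
    proof (rule frechet_subdifferential_fermat)
      show "\<bar>J s\<bar> \<noteq> \<infinity>" by (rule J(2)[OF subsetD[OF sub s]])
      show "((\<lambda>y. a \<bullet> (y - x) + n * ((y - t) \<bullet> (y - t))) has_derivative (\<lambda>h. (a + z) \<bullet> h)) (at s)"
        by (auto intro!: derivative_eq_intros simp: z_def algebra_simps inner_commute)
      have "\<forall>\<^sub>F y in at s. y \<in> ball x r"
        using sx by (intro eventually_at_in_open') (auto simp: dist_norm norm_minus_commute)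
      then show "\<forall>\<^sub>F y in at s. J s + ereal (a \<bullet> (s - x) + n * ((s - t) \<bullet> (s - t)))
          \<le> J y + ereal (a \<bullet> (y - x) + n * ((y - t) \<bullet> (y - t)))"
      proof eventually_elim
        case (elim y)
        then have y: "y \<in> cball x r" by simp
        then have "(y, t) \<in> S" using t by (simp add: S_def)
        from st(2)[OF this] show ?case
          using Jj[OF subsetD[OF sub s]] Jj[OF subsetD[OF sub y]] by (simp add: \<psi>_def power2_norm_eq_inner)
      qed
    qed
    then show ?thesis by simp
  qed
  \<comment> \<open>Now \<open>s\<close> is fixed and \<open>t\<close> moves along the segment
    towards \<open>\<zeta>\<close>.\<close>
  moreover have "z \<bullet> (\<zeta> - t) \<le> e * norm (\<zeta> - t)" if \<zeta>: "\<zeta> \<in> U" for \<zeta>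
  proof (cases "\<zeta> = t")
    case False
    define D where "D = norm (\<zeta> - t)"
    have D: "D > 0" using False by (simp add: D_def)
    show ?thesis
    proof (rule field_le_epsilon)
      fix e' :: real assume e': "e' > 0"
      \<comment> \<open>The three caps keep \<open>t'\<close> on the segment, hence in
        \<open>U\<close>, keep it in the ball of radius \<open>r\<close>, and make the quadratic
        remainder, after division by \<open>\<tau>\<close>, at most \<open>e'\<close>.\<close>
      define \<tau> where "\<tau> = min 1 (min (r / 2 / D) (e' / (n * D\<^sup>2)))"
      have \<tau>: "\<tau> > 0" "\<tau> \<le> 1" "\<tau> \<le> r / 2 / D" "\<tau> \<le> e' / (n * D\<^sup>2)"
        using r D n e' by (auto simp: \<tau>_def)
      then have \<tau>': "\<tau> * D \<le> r / 2" "n * \<tau> * D\<^sup>2 \<le> e'"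
        using D n by (auto simp: pos_le_divide_eq mult_ac)
      define t' where "t' = t + \<tau> *\<^sub>R (\<zeta> - t)"
      have "t' = (1 - \<tau>) *\<^sub>R t + \<tau> *\<^sub>R \<zeta>" by (simp add: t'_def algebra_simps)
      then have "t' \<in> U" using convexD[OF U(2) t(1) \<zeta>] \<tau> by simp
      have t'x: "norm (t' - x) \<le> norm (t - x) + \<tau> * D"
        using norm_triangle_ineq[of "t - x" "\<tau> *\<^sub>R (\<zeta> - t)"] \<tau>(1) by (simp add: t'_def D_def add_diff_eq diff_add_eq)
      then have "norm (t' - x) \<le> r" using tx \<tau>' by linarith
      then have "(s, t') \<in> S"
        using \<open>t' \<in> U\<close> s by (auto simp: S_def dist_norm norm_minus_commute)
      from st(2)[OF this]
      have "2 * \<epsilon> * norm (t - x) + n * (norm (s - t))\<^sup>2 \<le> 2 * \<epsilon> * norm (t' - x) + n * (norm (s - t'))\<^sup>2"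
        by (simp add: \<psi>_def)
      moreover have "2 * \<epsilon> * norm (t' - x) \<le> 2 * \<epsilon> * (norm (t - x) + \<tau> * D)"
        using t'x \<epsilon> by (intro mult_left_mono) auto
      moreover have "n * (norm (s - t'))\<^sup>2 = n * (norm (s - t))\<^sup>2 - \<tau> * (z \<bullet> (\<zeta> - t)) + n * \<tau>\<^sup>2 * D\<^sup>2"
      proof -
        have "s - t' = (s - t) - \<tau> *\<^sub>R (\<zeta> - t)" by (simp add: t'_def)
        then have "(norm (s - t'))\<^sup>2
            = (norm (s - t))\<^sup>2 - 2 * \<tau> * ((s - t) \<bullet> (\<zeta> - t)) + \<tau>\<^sup>2 * D\<^sup>2"
          unfolding D_def power2_norm_eq_inner
          by (simp only: inner_diff_left[of "s - t"] inner_diff_right[of _ "s - t"] inner_scaleR_left inner_scaleR_right)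
            (simp add: inner_commute[of "\<zeta> - t" "s - t"] power2_eq_square right_diff_distrib)
        then show ?thesis
          unfolding z_def inner_scaleR_left by (simp add: left_diff_distrib right_diff_distrib distrib_left)
      qed
      ultimately have "\<tau> * (z \<bullet> (\<zeta> - t)) \<le> \<tau> * (2 * \<epsilon> * D + n * \<tau> * D\<^sup>2)"
        by (simp add: algebra_simps power2_eq_square)
      then have "z \<bullet> (\<zeta> - t) \<le> 2 * \<epsilon> * D + n * \<tau> * D\<^sup>2" using \<tau> by simp
      then show "z \<bullet> (\<zeta> - t) \<le> e * norm (\<zeta> - t) + e'" using \<tau>' by (simp add: \<epsilon>_def D_def)
    qed
  qed simp
  ultimately show ?thesis using sx tx r t s sub
    by (intro exI[of _ s] exI[of _ t] exI[of _ z]) auto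
qed

text \<open>On the whole space the unconstrained rule applies at once. Otherwise the penalised rule
  is used with errors tending to 0; the approximate normals are uniformly bounded, so a subsequence
  converges to a normal \<open>z\<close>, with \<open>- a - z\<close> as limiting
  subgradient.\<close>

lemma constrained_fermat:
  fixes J :: "'a::euclidean_space \<Rightarrow> ereal"
  assumes U: "closed U" "convex U" "x \<in> U"
    and fin: "\<bar>J x\<bar> \<noteq> \<infinity>"
    and lip: "U \<noteq> UNIV \<Longrightarrow> lipschitz_around J x"
    and g: "(g has_derivative (\<lambda>h. a \<bullet> h)) (at x)"
    and min: "\<And>y. y \<in> U \<Longrightarrow> J x + ereal (g x) \<le> J y + ereal (g y)"
  shows "\<exists>\<xi>\<in>limiting_subdifferential J x. \<exists>\<zeta>\<in>normal_cone U x. \<xi> + \<zeta> = - a"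
proof (cases "U = UNIV")
  case True
  have "- a \<in> limiting_subdifferential J x"
    using True by (intro subsetD[OF frechet_subdifferential_subset_limiting]
        frechet_subdifferential_fermat[of J x g a] fin g always_eventually) (simp add: min)
  moreover have "0 \<in> normal_cone U x" by (simp add: normal_cone_def)
  ultimately show ?thesis by (metis add.right_neutral)
next
  case False
  obtain r0 L where J: "0 < r0" "\<And>y. y \<in> ball x r0 \<Longrightarrow> \<bar>J y\<bar> \<noteq> \<infinity>"
      "L-lipschitz_on (ball x r0) (\<lambda>y. real_of_ereal (J y))"
    using lip[OF False] unfolding lipschitz_around_def by (elim exE conjE) (rule that, auto)
  define e :: "nat \<Rightarrow> real" where "e k = inverse (Suc k)" for k
  have "e k > 0" for k by (simp add: e_def)
  from penalised_fermat[OF U J g min this] obtain X Y Z where XYZ: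
    "\<And>k. norm (X k - x) < e k \<and> X k \<in> ball x r0 \<and> Y k \<in> U \<and> norm (Y k - x) < e k
      \<and> norm (Z k) \<le> 2 * (L + norm a) \<and> - a - Z k \<in> frechet_subdifferential J (X k)
      \<and> (\<forall>\<zeta>\<in>U. Z k \<bullet> (\<zeta> - Y k) \<le> e k * norm (\<zeta> - Y k))"
    by moura
  then have
    X: "\<And>k. norm (X k - x) < e k" "\<And>k. X k \<in> ball x r0"
    and Y: "\<And>k. Y k \<in> U" "\<And>k. norm (Y k - x) < e k"
    and Z: "\<And>k. norm (Z k) \<le> 2 * (L + norm a)" "\<And>k. - a - Z k \<in> frechet_subdifferential J (X k)"
      "\<And>k \<zeta>. \<zeta> \<in> U \<Longrightarrow> Z k \<bullet> (\<zeta> - Y k) \<le> e k * norm (\<zeta> - Y k)"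
    by blast+
  have e0: "e \<longlonglongrightarrow> 0" unfolding e_def by (rule LIMSEQ_inverse_real_of_nat)
  have Xx: "X \<longlonglongrightarrow> x"
    by (rule LIM_zero_cancel, rule Lim_null_comparison[OF _ e0]) (use X in \<open>auto intro!: always_eventually less_imp_le\<close>)
  have Yx: "Y \<longlonglongrightarrow> x"
    by (rule LIM_zero_cancel, rule Lim_null_comparison[OF _ e0]) (use Y in \<open>auto intro!: always_eventually less_imp_le\<close>)
  have "bounded (range Z)" using Z(1) by (auto simp: bounded_iff)
  then obtain z \<rho> where \<rho>: "strict_mono (\<rho> :: nat \<Rightarrow> nat)" and z: "(Z \<circ> \<rho>) \<longlonglongrightarrow> z"
    using bounded_imp_convergent_subsequence by blast
  \<comment> \<open>A limiting subgradient also requires convergence of the values of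
    \<open>J\<close>, which the local Lipschitz property provides.\<close>
  have "isCont (\<lambda>y. real_of_ereal (J y)) x"
    using lipschitz_on_continuous_on[OF J(3)] J(1) by (simp add: continuous_on_eq_continuous_at)
  then have "(\<lambda>k. real_of_ereal (J (X k))) \<longlonglongrightarrow> real_of_ereal (J x)"
    using Xx by (rule isCont_tendsto_compose)
  then have "(\<lambda>k. ereal (real_of_ereal (J (X k)))) \<longlonglongrightarrow> ereal (real_of_ereal (J x))"
    by (rule tendsto_ereal)
  then have JX: "(\<lambda>k. J (X k)) \<longlonglongrightarrow> J x" using J(2)[OF X(2)] fin by (simp add: ereal_real)
  have "- a - z \<in> limiting_subdifferential J x"
    unfolding limiting_subdifferential_def mem_Collect_eq
  proof (rule conjI[OF fin], rule exI[of _ "X \<circ> \<rho>"], rule exI[of _ "\<lambda>k. - a - (Z \<circ> \<rho>) k"], intro conjI)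
    show "(\<lambda>k. J ((X \<circ> \<rho>) k)) \<longlonglongrightarrow> J x" using LIMSEQ_subseq_LIMSEQ[OF JX \<rho>] by (simp add: o_def)
    show "(\<lambda>k. - a - (Z \<circ> \<rho>) k) \<longlonglongrightarrow> - a - z" by (intro tendsto_intros z)
  qed (use Z fin LIMSEQ_subseq_LIMSEQ[OF Xx \<rho>] in auto)
  moreover have "z \<in> normal_cone U x"
    unfolding normal_cone_def mem_Collect_eq
  proof
    fix \<zeta> assume \<zeta>: "\<zeta> \<in> U"
    have "(\<lambda>k. (Z \<circ> \<rho>) k \<bullet> (\<zeta> - (Y \<circ> \<rho>) k)) \<longlonglongrightarrow> z \<bullet> (\<zeta> - x)"
      by (intro tendsto_intros z LIMSEQ_subseq_LIMSEQ[OF Yx \<rho>])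
    moreover have "(\<lambda>k. (e \<circ> \<rho>) k * norm (\<zeta> - (Y \<circ> \<rho>) k)) \<longlonglongrightarrow> 0 * norm (\<zeta> - x)"
      by (intro tendsto_intros LIMSEQ_subseq_LIMSEQ[OF Yx \<rho>] LIMSEQ_subseq_LIMSEQ[OF e0 \<rho>])
    ultimately have "z \<bullet> (\<zeta> - x) \<le> 0 * norm (\<zeta> - x)"
      by (rule LIMSEQ_le) (use Z(3)[OF \<zeta>] in auto)
    then show "z \<bullet> (\<zeta> - x) \<le> 0" by simp
  qed
  ultimately show ?thesis by (metis diff_add_cancel)
qed

section \<open>From the Kurdyka-Lojasiewicz inequality to the value error bound\<close>

text \<open>With exponent 1/2 the square root of the value gap is at most
  \<open>\<kappa> * C\<close> times the step length; squaring gives the coefficient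
  \<open>(\<kappa> * C)\<^sup>2\<close>. The summand \<open>\<nu>\<close> of the final constant pays
  for steps longer than 1.\<close>

lemma KL_half_imp_VP_EB:
  assumes KL: "KL_property f S a (1/2) \<eta> \<nu> \<kappa>"
    and MInf: "\<And>x. f x \<noteq> -\<infinity>"
    and err: "\<And>k. w (Suc k) \<in> ball a \<eta> \<Longrightarrow> norm (w k - w (Suc k)) \<le> 1 \<Longrightarrow> f (w (Suc k)) \<noteq> \<infinity>
      \<Longrightarrow> \<exists>z\<in>S (w (Suc k)). norm z \<le> C * norm (w k - w (Suc k))"
  shows "VP_EB f w a"
proof -
  have pos: "0 < \<eta>" "0 < \<nu>" "0 < \<kappa>" using KL by (auto simp: KL_property_def)
  have "f (w (Suc k)) - f a \<le> ereal ((\<nu> + (\<kappa> * C)\<^sup>2) * (norm (w k - w (Suc k)))\<^sup>2)"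
    if k: "w (Suc k) \<in> ball a \<eta>" "f (w (Suc k)) < f a + ereal \<nu>" for k
  proof -
    define N where "N = norm (w k - w (Suc k))"
    have fin: "f (w (Suc k)) \<noteq> \<infinity>" using k(2) by auto
    then obtain b where b: "f (w (Suc k)) = ereal b" using MInf by (cases "f (w (Suc k))") auto
    show ?thesis
    proof (cases "f a")
      case (real c)
      have bc: "b < c + \<nu>" using k(2) by (simp add: b real)
      have "b - c \<le> (\<nu> + (\<kappa> * C)\<^sup>2) * N\<^sup>2"
      \<comment> \<open>The inequality speaks only of values strictly above \<open>f a\<close>; at
        or below it the gap is not positive and the bound is trivial.\<close>
      proof (cases "b \<le> c")
        case True
        moreover have "0 \<le> (\<nu> + (\<kappa> * C)\<^sup>2) * N\<^sup>2" using pos by simp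
        ultimately show ?thesis by simp
      next
        case False
        show ?thesis
        proof (cases "N \<le> 1")
          case True
          with err[OF k(1) _ fin] obtain z where z: "z \<in> S (w (Suc k))" "norm z \<le> C * N"
            by (auto simp: N_def)
          have "edist 0 (S (w (Suc k))) \<le> ereal (norm z)"
            unfolding edist_def by (rule INF_lower2[OF z(1)]) simp
          then have "ereal \<kappa> * edist 0 (S (w (Suc k))) \<le> ereal \<kappa> * ereal (norm z)"
            using pos by (intro ereal_mult_left_mono) auto
          moreover have "ereal ((b - c) powr (1/2)) \<le> ereal \<kappa> * edist 0 (S (w (Suc k)))"
            using KL[unfolded KL_property_def] k False by (auto simp: b real dest!: bspec[of _ _ "w (Suc k)"])
          ultimately have "ereal ((b - c) powr (1/2)) \<le> ereal (\<kappa> * norm z)"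
            unfolding times_ereal.simps by (rule order_trans[rotated])
          then have "(b - c) powr (1/2) \<le> \<kappa> * norm z" by simp
          then have "sqrt (b - c) \<le> \<kappa> * norm z" using False by (simp add: powr_half_sqrt)
          also have "\<dots> \<le> \<kappa> * (C * N)" using z(2) pos by simp
          finally have "(sqrt (b - c))\<^sup>2 \<le> (\<kappa> * (C * N))\<^sup>2" using False by (intro power_mono) auto
          then have "b - c \<le> (\<kappa> * C)\<^sup>2 * N\<^sup>2" using False by (simp add: power_mult_distrib mult_ac)
          moreover have "0 \<le> \<nu> * N\<^sup>2" using pos by simp
          ultimately show ?thesis by (simp add: distrib_right)
        next
          \<comment> \<open>For long steps the condition is implied by the restriction on the values.\<close>
          case False
          then have "\<nu> * 1 \<le> (\<nu> + (\<kappa> * C)\<^sup>2) * N\<^sup>2" using pos by (intro mult_mono) auto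
          with bc show ?thesis by simp
        qed
      qed
      then show ?thesis by (simp add: b real N_def)
    next
      \<comment> \<open>An infinite \<open>f a\<close> makes the difference minus infinity.\<close>
      case PInf
      then show ?thesis by (simp add: b)
    next
      case MInf
      then show ?thesis using assms(2) by blast
    qed
  qed
  moreover have "0 < \<nu> + (\<kappa> * C)\<^sup>2" using pos by (simp add: add_pos_nonneg)
  ultimately show ?thesis using pos unfolding VP_EB_def by blast
qed

text \<open>Subtracting the two bounds gives \<open>(1 - \<sigma>) * d \<ge> 0\<close>, hence
  \<open>d \<ge> 0\<close>. If \<open>d\<close> is positive, so is \<open>s\<close>, and inverting
  the lower bound gives the claim; if \<open>d = 0\<close>, then \<open>s = e = 0\<close> and both
  sides vanish, since \<open>1 / 0 = 0\<close>.\<close>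

lemma inverse_step_size_bounds:
  fixes \<sigma> \<beta> s e :: real
  assumes "0 < \<sigma>" "\<sigma> < 1" "0 < \<beta>" "\<sigma> * (\<beta> * inverse s) \<le> e" "e \<le> \<beta> * inverse s"
  shows "0 \<le> 1 / e" "1 / e \<le> \<bar>s\<bar> / (\<sigma> * \<beta>)"
proof -
  define d where "d = \<beta> * inverse s"
  have "(1 - \<sigma>) * d \<ge> 0" using order_trans[OF assms(4,5)] unfolding d_def[symmetric] by (simp add: left_diff_distrib)
  then have d0: "d \<ge> 0" using assms by (simp add: zero_le_mult_iff)
  have *: "0 \<le> 1 / e \<and> 1 / e \<le> \<bar>s\<bar> / (\<sigma> * \<beta>)"
  proof (cases "d = 0")
    case True
    then have "e = 0" using assms by (simp add: d_def)
    then show ?thesis using assms by simp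
  next
    case False
    then have s: "s > 0" using d0 assms by (auto simp: d_def zero_le_mult_iff)
    have e: "\<sigma> * d \<le> e" "0 < \<sigma> * d" using False d0 assms(1,4) by (simp_all flip: d_def)
    then have "1 / e \<le> 1 / (\<sigma> * d)" by (intro frac_le) auto
    also have "\<dots> = \<bar>s\<bar> / (\<sigma> * \<beta>)" using s assms by (simp add: d_def field_simps)
    finally show ?thesis using e by simp
  qed
  then show "0 \<le> 1 / e" "1 / e \<le> \<bar>s\<bar> / (\<sigma> * \<beta>)" by auto
qed

lemma transpose_add_vector:
  fixes A A' :: "real^'n^'m"
  shows "transpose (A + A') *v y = transpose A *v y + transpose A' *v y"
proof -
  have "transpose (A + A') = transpose A + transpose A'" by (simp add: transpose_def vec_eq_iff)
  then show ?thesis by (simp add: matrix_vector_mult_add_rdistrib del: transpose_matrix_vector)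
qed

section \<open>Subgradients of the augmented Lagrangian bounded by the step length\<close>

theorem proposition6p1:
  fixes U :: "(real^'n) set"
    and G :: "(real^'n) \<times> (real^'d) \<Rightarrow> real"
    and J :: "(real^'n) \<Rightarrow> ereal"
    and H :: "(real^'d) \<Rightarrow> real"
    and \<Omega> \<Phi> \<Theta> :: "(real^'n) \<Rightarrow> (real^'m)"
    and B :: "real^'d^'m"
    and K :: "(real^'n) \<Rightarrow> real"
    and L_G L_H L_\<Theta> L_\<Omega> L_K \<beta> \<gamma> \<sigma> :: real
    and l_\<Omega> :: "'m \<Rightarrow> real"
    and u :: "nat \<Rightarrow> (real^'n)"
    and v :: "nat \<Rightarrow> (real^'d)"
    and p q :: "nat \<Rightarrow> (real^'m)"
    and \<delta> \<epsilon> :: "nat \<Rightarrow> real"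
    and w :: "nat \<Rightarrow> (real^'n) \<times> (real^'d) \<times> (real^'m)"
    and w_bar :: "(real^'n) \<times> (real^'d) \<times> (real^'m)"
    and \<eta> \<nu> \<kappa>\<^sub>2 :: real
  \<comment> \<open>Problem data\<close>
  assumes U: "U \<noteq> {}" "closed U" "convex U"
    and Theta: "\<Theta> = (\<lambda>x. \<Omega> x + \<Phi> x)"
    and Omega_diff: "\<forall>x. \<Omega> differentiable (at x)"
    and Phi_diff: "\<forall>x. \<Phi> differentiable (at x)"
  \<comment> \<open>Assumption 1\<close>
    and H1: "\<forall>x. G differentiable (at x)" "L_G-lipschitz_on UNIV (gradient G)"
    and H2: "\<forall>x. H differentiable (at x)" "L_H-lipschitz_on UNIV (gradient H)"
    and H3: "proper J" "lower_semicontinuous J"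
            "U = UNIV \<Longrightarrow> convex (edom J)"
            "U \<noteq> UNIV \<Longrightarrow> \<forall>x\<in>edom J \<inter> U. lipschitz_around J x"
    and H4: "L_\<Theta>-lipschitz_on UNIV \<Theta>"
    and H5: "\<forall>j. (l_\<Omega> j)-lipschitz_on UNIV (gradient (\<lambda>x. \<Omega> x $ j))"
            "L_\<Omega> = (\<Sum>j\<in>UNIV. l_\<Omega> j)"
    and H6: "CARD('d) \<le> CARD('m)" "rank B = CARD('d)" "range \<Theta> \<subseteq> range ((*v) B)"
    and H7: "\<exists>c::real. \<forall>x y. \<Theta> x + B *v y = 0 \<longrightarrow> ereal c \<le> objective G J H (x, y)"
            "(objective G J H \<longlongrightarrow> \<infinity>) (inf at_infinity (principal {(x, y). \<Theta> x + B *v y = 0}))"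
  \<comment> \<open>Assumption 2\<close>
    and K: "\<forall>x. K differentiable (at x)" "\<beta> > 0" "strongly_convex \<beta> K"
           "L_K-lipschitz_on UNIV (gradient K)"
    and gamma: "\<gamma> > 0"
      "\<gamma> > (sqrt 57 + 1) / (2 * lambda_min (transpose B ** B)) * (L_G + L_H)"
  \<comment> \<open>Algorithm NAPP-AL\<close>
    and sigma: "0 < \<sigma>" "\<sigma> < 1"
    and q: "\<forall>k. q k = p k + \<gamma> *\<^sub>R (\<Theta> (u k) + B *v v k)"
    and delta: "\<forall>k. \<delta> k = \<beta> * inverse (L_G + norm (q k) * L_\<Omega> + \<gamma> * L_\<Theta>\<^sup>2
          + 14 * \<gamma> * (spectral_norm B)\<^sup>2 * L_\<Theta>\<^sup>2 / lambda_min (transpose B ** B)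
          + 14 * (L_G + \<gamma> * spectral_norm B * L_\<Theta>)\<^sup>2 / (\<gamma> * lambda_min (transpose B ** B))
          + 1)"
    and epsilon: "\<forall>k. \<sigma> * \<delta> k \<le> \<epsilon> k \<and> \<epsilon> k \<le> \<delta> k"
    and u_step: "\<forall>k. is_arg_min
          (\<lambda>x. ereal (gradient (\<lambda>x'. G (x', v k)) (u k) \<bullet> x) + J x
             + ereal (q k \<bullet> (jacobian \<Omega> (at (u k)) *v x + \<Phi> x))
             + ereal (1 / \<epsilon> k * bregman K x (u k)))
          (\<lambda>x. x \<in> U) (u (Suc k))"
    and v_step: "\<forall>k. is_arg_min
          (\<lambda>y. (gradient (\<lambda>y'. G (u k, y')) (v k) + gradient H (v k)) \<bullet> y
             + q k \<bullet> (B *v y) + \<gamma> / 2 * (norm (B *v (y - v k)))\<^sup>2)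
          (\<lambda>y. True) (v (Suc k))"
    and p_step: "\<forall>k. p (Suc k) = p k + \<gamma> *\<^sub>R (\<Theta> (u (Suc k)) + B *v v (Suc k))"
    and w: "\<forall>k. w k = (u k, v k, p k)"
    and w_bar: "accumulation_point w w_bar"
    and KL: "KL_property (augmented_lagrangian G J H \<Theta> B \<gamma>)
               (augmented_lagrangian_subdifferential U G J H \<Theta> B \<gamma>) w_bar (1/2) \<eta> \<nu> \<kappa>\<^sub>2"
  shows "VP_EB (augmented_lagrangian G J H \<Theta> B \<gamma>) w w_bar"
proof -
  \<comment> \<open>This rule rewrites \<open>transpose A *v x\<close> to \<open>x v* A\<close> and
    would hide the form in which the lemmas above are stated.\<close>
  note [simp del] = transpose_matrix_vector
  let ?f = "augmented_lagrangian G J H \<Theta> B \<gamma>"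
  let ?S = "augmented_lagrangian_subdifferential U G J H \<Theta> B \<gamma>"
  have J_MInf: "J x \<noteq> -\<infinity>" for x using H3(1) by (simp add: proper_def)
  then have f_MInf: "?f x \<noteq> -\<infinity>" for x
    by (cases x, cases "J (fst x)") (auto simp: augmented_lagrangian_def objective_def)
  obtain b where b: "b > 0" "\<And>x. norm (B *v x) \<le> b * norm x"
    using bounded_linear.pos_bounded[OF matrix_vector_mul_bounded_linear[of B]] by (auto simp: mult.commute)
  obtain b' where b': "b' > 0" "\<And>x. norm (transpose B *v x) \<le> b' * norm x"
    using bounded_linear.pos_bounded[OF matrix_vector_mul_bounded_linear[of "transpose B"]]
    by (auto simp: mult.commute)
  have nonneg: "0 \<le> L_G" "0 \<le> L_H" "0 \<le> L_\<Theta>" "0 \<le> L_K" "0 \<le> L_\<Omega>"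
    using H1(2) H2(2) H4 K(4) H5 lipschitz_on_nonneg by (blast, blast, blast, blast, metis sum_nonneg)
  have Theta_diff: "\<Theta> differentiable (at x)" for x
    unfolding Theta using Omega_diff Phi_diff by (intro differentiable_add) auto
  have jacobian_Theta: "jacobian \<Theta> (at x) = jacobian \<Omega> (at x) + jacobian \<Phi> (at x)" for x
  proof (rule jacobian_unique)
    show "(\<Theta> has_derivative (\<lambda>h. (jacobian \<Omega> (at x) + jacobian \<Phi> (at x)) *v h)) (at x)"
      unfolding Theta matrix_vector_mult_add_rdistrib
      using Omega_diff Phi_diff by (intro has_derivative_add jacobian_works[THEN iffD1]) auto
  qed
  \<comment> \<open>The part of the denominator of \<open>\<delta> k\<close> that is the same for
    all \<open>k\<close>.\<close>
  define S0 where "S0 = L_G + \<gamma> * L_\<Theta>\<^sup>2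
          + 14 * \<gamma> * (spectral_norm B)\<^sup>2 * L_\<Theta>\<^sup>2 / lambda_min (transpose B ** B)
          + 14 * (L_G + \<gamma> * spectral_norm B * L_\<Theta>)\<^sup>2 / (\<gamma> * lambda_min (transpose B ** B)) + 1"
  have \<delta>: "\<delta> k = \<beta> * inverse (S0 + norm (q k) * L_\<Omega>)" for k
    using delta by (simp add: S0_def add_ac)
  \<comment> \<open>Bounds independent of \<open>k\<close>: \<open>R\<close> for
    \<open>norm (w k)\<close>, \<open>Q\<close> for \<open>norm (q k)\<close>, \<open>E\<close> for
    \<open>1 / \<epsilon> k\<close>, and \<open>Cq\<close> for the change of \<open>q\<close> per
    step length. \<open>C\<close> adds the bounds of the three components of the
    subgradient.\<close>
  define R where "R = norm w_bar + \<eta> + 1"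
  define Q where "Q = R + \<gamma> * (norm (\<Theta> 0) + L_\<Theta> * R + b * R)"
  define E where "E = (\<bar>S0\<bar> + Q * L_\<Omega>) / (\<sigma> * \<beta>)"
  define Cq where "Cq = 1 + \<gamma> * (L_\<Theta> + b)"
  define C where "C = (2 * L_G + L_\<Theta> * Cq + Q * L_\<Omega> + E * L_K)
    + (2 * L_G + L_H + b' * Cq + \<gamma> * (b' * b)) + 1 / \<gamma>"
  show ?thesis
  proof (rule KL_half_imp_VP_EB[OF KL f_MInf, where C = C])
    fix k
    assume near: "w (Suc k) \<in> ball w_bar \<eta>" and small: "norm (w k - w (Suc k)) \<le> 1"
      and fin: "?f (w (Suc k)) \<noteq> \<infinity>"
    let ?u = "u k" and ?u' = "u (Suc k)" and ?v = "v k" and ?v' = "v (Suc k)"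
    define N where "N = norm (w k - w (Suc k))"
    have w_diff: "w k - w (Suc k) = (?u - ?u', ?v - ?v', p k - p (Suc k))" using w by simp
    have uN: "norm (?u' - ?u) \<le> N" and vpN: "norm (?v - ?v', p k - p (Suc k)) \<le> N"
      unfolding N_def w_diff using norm_fst_le[of "?u - ?u'" "(?v - ?v', p k - p (Suc k))"]
        norm_snd_le[of "(?v - ?v', p k - p (Suc k))" "?u - ?u'"] by (simp_all add: norm_minus_commute)
    have vN: "norm (?v' - ?v) \<le> N" and pN: "norm (p (Suc k) - p k) \<le> N"
      using vpN norm_fst_le[of "?v - ?v'" "p k - p (Suc k)"] norm_snd_le[of "p k - p (Suc k)" "?v - ?v'"]
      by (simp_all add: norm_minus_commute)
    have N0: "0 \<le> N" by (simp add: N_def)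

    \<comment> \<open>Boundedness of the iterate and variation of the multiplier estimate\<close>
    have "norm (w k) \<le> norm (w k - w (Suc k)) + norm (w (Suc k) - w_bar) + norm w_bar"
      by (smt (verit) norm_triangle_sub norm_minus_commute)
    then have wR: "norm (w k) \<le> R" using near small by (simp add: R_def dist_norm norm_minus_commute)
    then have vpR: "norm (?v, p k) \<le> R" and uR: "norm ?u \<le> R"
      using w norm_fst_le[of ?u "(?v, p k)"] norm_snd_le[of "(?v, p k)" ?u] by auto
    then have vR: "norm ?v \<le> R" and pR: "norm (p k) \<le> R"
      using norm_fst_le[of ?v "p k"] norm_snd_le[of "p k" ?v] by auto
    have qQ: "norm (q k) \<le> Q"
    proof -
      have "norm (\<Theta> ?u) \<le> norm (\<Theta> 0) + norm (\<Theta> ?u - \<Theta> 0)" by (rule norm_triangle_sub)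
      also have "norm (\<Theta> ?u - \<Theta> 0) \<le> L_\<Theta> * norm ?u" using lipschitz_onD[OF H4, of ?u 0] by (simp add: dist_norm)
      also have "\<dots> \<le> L_\<Theta> * R" using uR nonneg by (intro mult_left_mono) auto
      finally have "norm (\<Theta> ?u) \<le> norm (\<Theta> 0) + L_\<Theta> * R" by simp
      moreover have "norm (B *v ?v) \<le> b * R" using b(2)[of ?v] vR b(1) by (meson mult_left_mono order_trans less_imp_le)
      ultimately have "norm (\<Theta> ?u + B *v ?v) \<le> norm (\<Theta> 0) + L_\<Theta> * R + b * R"
        by (intro norm_triangle_le) auto
      then have "norm (\<gamma> *\<^sub>R (\<Theta> ?u + B *v ?v)) \<le> \<gamma> * (norm (\<Theta> 0) + L_\<Theta> * R + b * R)"
        using gamma by simp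
      then show ?thesis using q pR by (simp add: Q_def norm_triangle_le)
    qed
    have q_diff: "norm (q (Suc k) - q k) \<le> Cq * N"
    proof -
      have "norm (\<Theta> ?u' - \<Theta> ?u) \<le> L_\<Theta> * N"
        using lipschitz_onD[OF H4, of ?u' ?u] mult_left_mono[OF uN nonneg(3)] by (simp add: dist_norm)
      moreover have "norm (B *v (?v' - ?v)) \<le> b * N"
        using b(2) mult_left_mono[OF vN less_imp_le[OF b(1)]] by (rule order_trans)
      ultimately have "norm ((\<Theta> ?u' - \<Theta> ?u) + B *v (?v' - ?v)) \<le> (L_\<Theta> + b) * N"
        by (intro norm_triangle_le) (simp add: distrib_right)
      then have "norm (\<gamma> *\<^sub>R ((\<Theta> ?u' - \<Theta> ?u) + B *v (?v' - ?v))) \<le> \<gamma> * ((L_\<Theta> + b) * N)"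
        using gamma by simp
      with pN have "norm ((p (Suc k) - p k) + \<gamma> *\<^sub>R ((\<Theta> ?u' - \<Theta> ?u) + B *v (?v' - ?v)))
          \<le> N + \<gamma> * ((L_\<Theta> + b) * N)" by (intro norm_triangle_le) simp
      moreover have "q (Suc k) - q k = (p (Suc k) - p k) + \<gamma> *\<^sub>R ((\<Theta> ?u' - \<Theta> ?u) + B *v (?v' - ?v))"
        using q by (simp add: algebra_simps matrix_vector_mult_diff_distrib)
      ultimately have "norm (q (Suc k) - q k) \<le> N + \<gamma> * ((L_\<Theta> + b) * N)" by metis
      then show ?thesis by (simp add: Cq_def algebra_simps)
    qed
    \<comment> \<open>The sandwich \<open>\<sigma> \<delta> \<le> \<epsilon> \<le> \<delta>\<close> with \<open>\<sigma> < 1\<close> forces \<open>\<delta> \<ge> 0\<close>, whatever the sign of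
      \<open>lambda_min\<close>.\<close>
    have \<epsilon>_bound: "0 \<le> 1 / \<epsilon> k" "1 / \<epsilon> k \<le> E"
    proof -
      have *: "\<sigma> * (\<beta> * inverse (S0 + norm (q k) * L_\<Omega>)) \<le> \<epsilon> k" "\<epsilon> k \<le> \<beta> * inverse (S0 + norm (q k) * L_\<Omega>)"
        using epsilon by (auto simp: \<delta>[symmetric])
      show "0 \<le> 1 / \<epsilon> k" by (rule inverse_step_size_bounds[OF sigma K(2) *])
      have "\<bar>S0 + norm (q k) * L_\<Omega>\<bar> \<le> \<bar>S0\<bar> + \<bar>norm (q k) * L_\<Omega>\<bar>" by (rule abs_triangle_ineq)
      also have "\<dots> \<le> \<bar>S0\<bar> + Q * L_\<Omega>" using qQ nonneg by (simp add: abs_mult mult_right_mono)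
      finally show "1 / \<epsilon> k \<le> E"
        using inverse_step_size_bounds(2)[OF sigma K(2) *] sigma K(2)
        unfolding E_def by (meson divide_right_mono order_trans mult_nonneg_nonneg less_imp_le)
    qed
    let ?gG = "\<lambda>i. gradient G (u i, v i)"
    have gG: "gradient (\<lambda>x. G (x, v i)) (u i) = fst (?gG i)" "gradient (\<lambda>y. G (u i, y)) (v i) = snd (?gG i)" for i
      using H1(1) by (simp_all add: gradient_Pair_fst gradient_Pair_snd)
    have gG_diff: "norm (?gG (Suc k) - ?gG k) \<le> 2 * L_G * N"
    proof -
      have "norm (?gG (Suc k) - ?gG k) \<le> L_G * norm (?u' - ?u, ?v' - ?v)"
        using lipschitz_onD[OF H1(2), of "(?u', ?v')" "(?u, ?v)"] by (simp add: dist_norm)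
      also have "\<dots> \<le> L_G * (N + N)"
        using norm_Pair_le[of "?u' - ?u" "?v' - ?v"] uN vN nonneg by (intro mult_left_mono) auto
      finally show ?thesis by simp
    qed
    have gGu_diff: "norm (fst (?gG (Suc k)) - fst (?gG k)) \<le> 2 * L_G * N"
      and gGv_diff: "norm (snd (?gG (Suc k)) - snd (?gG k)) \<le> 2 * L_G * N"
      using gG_diff norm_fst_le[of "fst (?gG (Suc k) - ?gG k)" "snd (?gG (Suc k) - ?gG k)", unfolded prod.collapse]
        norm_snd_le[of "snd (?gG (Suc k) - ?gG k)" "fst (?gG (Suc k) - ?gG k)", unfolded prod.collapse]
      unfolding fst_diff snd_diff by linarith+

    \<comment> \<open>Optimality in the nonsmooth subproblem\<close>
    \<comment> \<open>The gradient at \<open>?u'\<close> of the smooth part \<open>g\<close> of the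
      subproblem: \<open>\<Omega>\<close> enters through its linearisation at \<open>?u\<close>, but
      \<open>\<Phi>\<close> is kept exactly and is differentiated at \<open>?u'\<close>.\<close>
    define a where "a = fst (?gG k) + transpose (jacobian \<Omega> (at ?u)) *v q k
      + transpose (jacobian \<Phi> (at ?u')) *v q k + (1 / \<epsilon> k) *\<^sub>R (gradient K ?u' - gradient K ?u)"
    define g where "g x = fst (?gG k) \<bullet> x + q k \<bullet> (jacobian \<Omega> (at ?u) *v x + \<Phi> x)
      + 1 / \<epsilon> k * bregman K x ?u" for x
    have u'U: "?u' \<in> U" using u_step by (simp add: is_arg_min_def)
    \<comment> \<open>Minimality alone does not exclude the value infinity; the finite Lagrangian
      value in \<open>fin\<close> does.\<close>
    have Jfin: "\<bar>J ?u'\<bar> \<noteq> \<infinity>"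
      using fin J_MInf[of ?u'] w by (cases "J ?u'") (auto simp: augmented_lagrangian_def objective_def)
    have "\<exists>\<xi>\<in>limiting_subdifferential J ?u'. \<exists>\<zeta>\<in>normal_cone U ?u'. \<xi> + \<zeta> = - a"
    proof (rule constrained_fermat[where J = J and g = g])
      show "closed U" "convex U" "?u' \<in> U" "\<bar>J ?u'\<bar> \<noteq> \<infinity>" by (fact U(2) U(3) u'U Jfin)+
      show "lipschitz_around J ?u'" if "U \<noteq> UNIV"
        using H3(4)[OF that] u'U Jfin by (auto simp: edom_def)
      have "(g has_derivative (\<lambda>h. fst (?gG k) \<bullet> h
          + q k \<bullet> (jacobian \<Omega> (at ?u) *v h + jacobian \<Phi> (at ?u') *v h)
          + 1 / \<epsilon> k * (gradient K ?u' \<bullet> h - 0 - gradient K ?u \<bullet> (h - 0)))) (at ?u')"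
        unfolding g_def bregman_def
        by (intro has_derivative_add has_derivative_diff has_derivative_mult_right has_derivative_inner_right
            has_derivative_const has_derivative_ident has_derivative_gradient K(1)[rule_format]
            bounded_linear_imp_has_derivative[OF matrix_vector_mul_bounded_linear]
            jacobian_works[THEN iffD1] Phi_diff[rule_format])
      then show "(g has_derivative (\<lambda>h. a \<bullet> h)) (at ?u')"
        by (simp add: a_def inner_add_left inner_diff_left inner_add_right inner_transpose_matrix_vector algebra_simps)
      fix y assume "y \<in> U"
      with u_step have "\<not> ereal (fst (?gG k) \<bullet> y) + J y
               + ereal (q k \<bullet> (jacobian \<Omega> (at ?u) *v y + \<Phi> y)) + ereal (1 / \<epsilon> k * bregman K y ?u)
            < ereal (fst (?gG k) \<bullet> ?u') + J ?u'
               + ereal (q k \<bullet> (jacobian \<Omega> (at ?u) *v ?u' + \<Phi> ?u')) + ereal (1 / \<epsilon> k * bregman K ?u' ?u)"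
        unfolding is_arg_min_def gG by blast
      then show "J ?u' + ereal (g ?u') \<le> J y + ereal (g y)"
        using Jfin J_MInf[of y] by (cases "J ?u'"; cases "J y") (auto simp: g_def)
    qed
    then obtain \<xi> \<zeta> where \<xi>\<zeta>: "\<xi> \<in> limiting_subdifferential J ?u'" "\<zeta> \<in> normal_cone U ?u'" "\<xi> + \<zeta> = - a"
      by blast

    \<comment> \<open>Optimality in the smooth subproblem\<close>
    have v_opt: "snd (?gG k) + gradient H ?v + transpose B *v q k
        + \<gamma> *\<^sub>R (transpose B *v (B *v (?v' - ?v))) = 0" (is "?c = 0")
    proof -
      let ?h = "\<lambda>y. (snd (?gG k) + gradient H ?v) \<bullet> y + q k \<bullet> (B *v y)
          + \<gamma> / 2 * ((B *v (y - ?v)) \<bullet> (B *v (y - ?v)))"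
      have lin: "((\<lambda>y. B *v (y - ?v)) has_derivative (\<lambda>h. B *v (h - 0))) (at ?v')"
        by (intro bounded_linear.has_derivative[OF matrix_vector_mul_bounded_linear]
            has_derivative_diff has_derivative_const has_derivative_ident)
      have "(?h has_derivative (\<lambda>h. (snd (?gG k) + gradient H ?v) \<bullet> h + q k \<bullet> (B *v h)
          + \<gamma> / 2 * ((B *v (?v' - ?v)) \<bullet> (B *v (h - 0)) + (B *v (h - 0)) \<bullet> (B *v (?v' - ?v))))) (at ?v')"
        by (intro has_derivative_add has_derivative_mult_right has_derivative_inner_right
            has_derivative_inner[OF lin lin] has_derivative_ident
            bounded_linear_imp_has_derivative[OF matrix_vector_mul_bounded_linear])
      moreover have "?h ?v' \<le> ?h y" for y
        using v_step unfolding is_arg_min_def gG power2_norm_eq_inner by (meson not_le)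
      ultimately have "(\<lambda>h. (snd (?gG k) + gradient H ?v) \<bullet> h + q k \<bullet> (B *v h)
          + \<gamma> / 2 * ((B *v (?v' - ?v)) \<bullet> (B *v (h - 0)) + (B *v (h - 0)) \<bullet> (B *v (?v' - ?v)))) = (\<lambda>h. 0)"
        by (intro has_derivative_local_min) (auto intro: always_eventually)
      from fun_cong[OF this]
      have "(snd (?gG k) + gradient H ?v) \<bullet> h + q k \<bullet> (B *v h)
          + \<gamma> / 2 * ((B *v (?v' - ?v)) \<bullet> (B *v h) + (B *v h) \<bullet> (B *v (?v' - ?v))) = 0" for h
        by simp
      moreover have "?c \<bullet> h = (snd (?gG k) + gradient H ?v) \<bullet> h + q k \<bullet> (B *v h)
          + \<gamma> / 2 * ((B *v (?v' - ?v)) \<bullet> (B *v h) + (B *v h) \<bullet> (B *v (?v' - ?v)))" for h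
        by (simp add: inner_add_left inner_transpose_matrix_vector inner_commute[of "B *v h" "B *v (?v' - ?v)"])
      ultimately have "?c \<bullet> h = 0" for h
        by metis
      then have "?c \<bullet> ?c = 0" .
      then show ?thesis by simp
    qed

    \<comment> \<open>A small subgradient at the new iterate\<close>
    define r where "r = \<Theta> ?u' + B *v ?v'"
    \<comment> \<open>The multiplier in the subdifferential at the new iterate is exactly
      \<open>q (Suc k)\<close>.\<close>
    have r: "p (Suc k) + \<gamma> *\<^sub>R r = q (Suc k)" using q by (simp add: r_def)
    define zu where "zu = fst (?gG (Suc k)) + \<xi> + \<zeta> + transpose (jacobian \<Theta> (at ?u')) *v q (Suc k)"
    define zv where "zv = snd (?gG (Suc k)) + gradient H ?v' + transpose B *v q (Suc k)"
    have "(zu, zv, r) \<in> ?S (w (Suc k))"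
      using \<xi>\<zeta>(1,2) u'U w r
      by (auto simp: augmented_lagrangian_subdifferential_def gG zu_def zv_def r_def)
    moreover have "norm zu \<le> (2 * L_G + L_\<Theta> * Cq + Q * L_\<Omega> + E * L_K) * N"
    proof -
      \<comment> \<open>After substituting \<open>\<xi> + \<zeta> = - a\<close> the
        \<open>\<Phi>\<close> terms with \<open>q k\<close> cancel, both being taken at
        \<open>?u'\<close>; \<open>\<Omega>\<close> leaves the difference of its Jacobians at
        \<open>?u'\<close> and \<open>?u\<close>.\<close>
      have "zu = (fst (?gG (Suc k)) - fst (?gG k)) + transpose (jacobian \<Theta> (at ?u')) *v (q (Suc k) - q k)
          + (transpose (jacobian \<Omega> (at ?u')) *v q k - transpose (jacobian \<Omega> (at ?u)) *v q k)
          - (1 / \<epsilon> k) *\<^sub>R (gradient K ?u' - gradient K ?u)"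
        using \<xi>\<zeta>(3) unfolding zu_def a_def add.assoc
        by (simp add: matrix_vector_mult_diff_distrib jacobian_Theta transpose_add_vector algebra_simps)
      also have "norm \<dots> \<le> 2 * L_G * N + L_\<Theta> * (Cq * N) + Q * L_\<Omega> * N + E * (L_K * N)"
      proof (rule norm_triangle_le_diff, rule add_mono, rule norm_triangle_le, rule add_mono,
          rule norm_triangle_le, rule add_mono, rule gGu_diff)
        show "norm (transpose (jacobian \<Theta> (at ?u')) *v (q (Suc k) - q k)) \<le> L_\<Theta> * (Cq * N)"
          using norm_transpose_jacobian_le[OF Theta_diff H4] mult_left_mono[OF q_diff nonneg(3)]
          by (rule order_trans)
        have "norm (q k) * L_\<Omega> * norm (?u' - ?u) \<le> Q * L_\<Omega> * N"
          using qQ uN nonneg order_trans[OF norm_ge_zero qQ] by (intro mult_mono mult_nonneg_nonneg) auto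
        then show "norm (transpose (jacobian \<Omega> (at ?u')) *v q k - transpose (jacobian \<Omega> (at ?u)) *v q k)
            \<le> Q * L_\<Omega> * N"
          using norm_transpose_jacobian_diff_le[of \<Omega> l_\<Omega> ?u' "q k" ?u] Omega_diff H5 by auto
        have "norm (gradient K ?u' - gradient K ?u) \<le> L_K * N"
          using lipschitz_onD[OF K(4), of ?u' ?u] mult_left_mono[OF uN nonneg(4)] by (simp add: dist_norm)
        then have "(1 / \<epsilon> k) * norm (gradient K ?u' - gradient K ?u) \<le> E * (L_K * N)"
          using \<epsilon>_bound order_trans[OF \<epsilon>_bound] by (intro mult_mono) auto
        then show "norm ((1 / \<epsilon> k) *\<^sub>R (gradient K ?u' - gradient K ?u)) \<le> E * (L_K * N)"
          using \<epsilon>_bound(1) by simp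
      qed
      finally show ?thesis by (simp add: algebra_simps)
    qed
    moreover have "norm zv \<le> (2 * L_G + L_H + b' * Cq + \<gamma> * (b' * b)) * N"
    proof -
      \<comment> \<open>Subtracting the vanishing optimality expression turns every term except the
        proximal one into a difference of successive values.\<close>
      have "zv = zv - ?c" using v_opt by simp
      also have "\<dots> = (snd (?gG (Suc k)) - snd (?gG k)) + (gradient H ?v' - gradient H ?v)
          + transpose B *v (q (Suc k) - q k) - \<gamma> *\<^sub>R (transpose B *v (B *v (?v' - ?v)))"
        by (simp add: zv_def matrix_vector_mult_diff_distrib algebra_simps)
      also have "norm \<dots> \<le> 2 * L_G * N + L_H * N + b' * (Cq * N) + \<gamma> * (b' * (b * N))"
      proof (rule norm_triangle_le_diff, rule add_mono, rule norm_triangle_le, rule add_mono,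
          rule norm_triangle_le, rule add_mono, rule gGv_diff)
        show "norm (gradient H ?v' - gradient H ?v) \<le> L_H * N"
          using lipschitz_onD[OF H2(2), of ?v' ?v] mult_left_mono[OF vN nonneg(2)] by (simp add: dist_norm)
        show "norm (transpose B *v (q (Suc k) - q k)) \<le> b' * (Cq * N)"
          using b'(2) mult_left_mono[OF q_diff less_imp_le[OF b'(1)]] by (rule order_trans)
        have "norm (B *v (?v' - ?v)) \<le> b * N"
          using b(2) mult_left_mono[OF vN less_imp_le[OF b(1)]] by (rule order_trans)
        then have "norm (transpose B *v (B *v (?v' - ?v))) \<le> b' * (b * N)"
          using b'(2) mult_left_mono less_imp_le[OF b'(1)] order_trans by metis
        then show "norm (\<gamma> *\<^sub>R (transpose B *v (B *v (?v' - ?v)))) \<le> \<gamma> * (b' * (b * N))"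
          using gamma by simp
      qed
      finally show ?thesis by (simp add: algebra_simps)
    qed
    moreover have "norm r \<le> 1 / \<gamma> * N"
    proof -
      \<comment> \<open>The multiplier update makes the constraint residual proportional to the
        change of \<open>p\<close>.\<close>
      have "p (Suc k) - p k = \<gamma> *\<^sub>R r" using p_step by (simp add: r_def)
      then have "\<gamma> * norm r \<le> N" using pN gamma by simp
      then show ?thesis using gamma by (simp add: field_simps)
    qed
    ultimately have "norm (zu, zv, r) \<le> C * norm (w k - w (Suc k))"
      using norm_Pair_le[of zu "(zv, r)"] norm_Pair_le[of zv r]
      unfolding N_def[symmetric] C_def distrib_right[of _ _ N] by linarith
    with \<open>(zu, zv, r) \<in> ?S (w (Suc k))\<close>
    show "\<exists>z\<in>?S (w (Suc k)). norm z \<le> C * norm (w k - w (Suc k))" by blast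
  qed
qed

end
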